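(* Let $L$ be a spatial frame. Then the frame $N(L)$ of nuclei on $L$ is spatial if and only if the topological space $(Y_L,\tau)$ is weakly scattered.
   Context: A frame is a complete lattice satisfying $a\wedge\bigvee S=\bigvee\{a\wedge s\mid s\in S\}$. A frame is spatial if it is isomorphic to the frame $\mathcal{O}(S)$ of open sets of some topological space $S$. A nucleus on a frame $L$ is a map $j:L\to L$ with $a\le ja$, $jja\le ja$, and $j(a\wedge b)=ja\wedge jb$ for all $a,b\in L$. $N(L)$ is the set of all nuclei on $L$ ordered by $j\le k$ iff $ja\le ka$ for all $a\in L$; it is a frame. The Esakia space $X_L$ of $L$ is the set of prime (proper) filters of $L$, ordered by inclusion, with the topology $\pi$ whose basis is $\{\varphi(a)\setminus\varphi(b)\mid a,b\in L\}$, where $\varphi(a)=\{x\in X_L\mid a\in x\}$. For $S\subseteq X_L$, ${\downarrow}S=\{x\mid x\le s\text{ for some }s\in S\}$; upsets are sets closed upward under $\le$. A closed subset $F$ of $X_L$ is nuclear if ${\downarrow}(U\cap F)$ is clopen for each clopen $U\subseteq X_L$. $Y_L$ is the set of nuclear points of $X_L$, i.e. of $y\in X_L$ such that $\{y\}$ is nuclear. $\tau$ is the subspace topology on $Y_L$ induced by the topology $\pi_u$ of open upsets of $X_L$ (so $\tau$-open sets are the sets $U\cap Y_L$ with $U$ a $\pi$-open upset of $X_L$). For a topological space $S$ and a subspace $T$, a point $x\in T$ is weakly isolated in $T$ if there is an open subset $U$ of $S$ with $x\in T\cap U\subseteq\overline{\{x\}}$ (closure in $S$). $S$ is weakly scattered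 if each nonempty closed subspace of $S$ has a weakly isolated point. *)

theory Defs
  imports "HOL-Analysis.Abstract_Topology"
begin

section \<open>Frames and spatiality\<close>

class frame = complete_lattice +
  assumes inf_Sup_frame: "inf a (Sup S) = Sup ((\<lambda>s. inf a s) ` S)"

definition order_iso :: "('a::order \<Rightarrow> 'b::order) \<Rightarrow> 'a set \<Rightarrow> 'b set \<Rightarrow> bool" where
  "order_iso h A B \<longleftrightarrow> bij_betw h A B \<and> (\<forall>a\<in>A. \<forall>b\<in>A. a \<le> b \<longleftrightarrow> h a \<le> h b)"

text \<open>A frame is given here by its ordered carrier \<open>A\<close>, so that the definition applies both to a
  whole type and to a set of functions; order isomorphisms preserve all existing joins and meets,
  so they are the frame isomorphisms. HOL does not quantify over types inside a formula, so the
  points of the space range over the type of the elements of \<open>A\<close>. The lemma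
  \<open>spatial_if_order_iso\<close> below shows that this is no restriction: spaces over any other type
  of points give nothing more.\<close>

definition spatial :: "'a::order set \<Rightarrow> bool" where
  "spatial A \<longleftrightarrow> (\<exists>(T :: 'a topology) h. order_iso h A {U. openin T U})"

lemma spatial_if_order_iso:
  fixes A :: "'a::order set" and T :: "'b topology"
  assumes "order_iso h A {U. openin T U}"
  shows "spatial A"
proof -
  define P where "P x = \<Union>{U. openin T U \<and> x \<notin> U}" for x
  define p where "p x = inv_into A h (P x)" for x
  have bij: "bij_betw h A {U. openin T U}"
    and ord: "\<And>a b. a \<in> A \<Longrightarrow> b \<in> A \<Longrightarrow> a \<le> b \<longleftrightarrow> h a \<subseteq> h b"
    using assms by (auto simp: order_iso_def)
  have opP: "openin T (P x)" for x
    unfolding P_def by (rule openin_Union) auto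
  have hp: "h (p x) = P x" for x
    unfolding p_def using bij opP by (simp add: bij_betw_inv_into_right)
  have nP: "x \<notin> P x" for x
    by (auto simp: P_def)
  have key: "x \<in> V" if "p x = p y" "y \<in> V" "openin T V" for x y V
  proof (rule ccontr)
    assume "x \<notin> V"
    then have "V \<subseteq> P x"
      using that(3) by (auto simp: P_def)
    moreover have "P x = P y"
      using that(1) hp by metis
    ultimately show False
      using that(2) nP by blast
  qed
  define O' where "O' W \<longleftrightarrow> (\<exists>U. openin T U \<and> W = p ` U)" for W
  have sub: "p ` U \<subseteq> p ` V \<longleftrightarrow> U \<subseteq> V" if "openin T U" "openin T V" for U V
    using key that by (auto simp: image_iff)
  have "istopology O'"
    unfolding istopology_def
  proof (intro conjI allI impI)
    fix S W assume "O' S" "O' W"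
    then obtain U V where *: "openin T U" "S = p ` U" "openin T V" "W = p ` V"
      by (auto simp: O'_def)
    then have "S \<inter> W = p ` (U \<inter> V)"
      using key by (auto simp: image_iff)
    then show "O' (S \<inter> W)"
      using * by (auto simp: O'_def)
  next
    fix K assume K: "\<forall>S\<in>K. O' S"
    have "\<Union>K = p ` \<Union>{U. openin T U \<and> p ` U \<in> K}"
    proof
      show "\<Union>K \<subseteq> p ` \<Union>{U. openin T U \<and> p ` U \<in> K}"
      proof
        fix y assume "y \<in> \<Union>K"
        then obtain W where "W \<in> K" "y \<in> W" by blast
        moreover from this K obtain U where "openin T U" "W = p ` U"
          unfolding O'_def by blast
        ultimately show "y \<in> p ` \<Union>{U. openin T U \<and> p ` U \<in> K}" by blast
      qed
    qed blast
    moreover have "openin T (\<Union>{U. openin T U \<and> p ` U \<in> K})"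
      by (rule openin_Union) auto
    ultimately show "O' (\<Union>K)"
      unfolding O'_def by blast
  qed
  then have op: "openin (topology O') W \<longleftrightarrow> O' W" for W
    by (simp add: topology_inverse')
  have oph: "openin T (h a)" if "a \<in> A" for a
    using bij that by (auto simp: bij_betw_def)
  have "order_iso (\<lambda>a. p ` h a) A {W. openin (topology O') W}"
    unfolding order_iso_def bij_betw_def
  proof (intro conjI ballI)
    show "inj_on (\<lambda>a. p ` h a) A"
    proof (rule inj_onI)
      fix a b assume ab: "a \<in> A" "b \<in> A" "p ` h a = p ` h b"
      then have "h a = h b"
        using sub[OF oph[OF ab(1)] oph[OF ab(2)]] sub[OF oph[OF ab(2)] oph[OF ab(1)]] by simp
      then show "a = b"
        using ab bij by (auto simp: bij_betw_def inj_on_def)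
    qed
    have "h ` A = {U. openin T U}"
      using bij by (simp add: bij_betw_def)
    then have "(\<lambda>a. p ` h a) ` A = (\<lambda>U. p ` U) ` {U. openin T U}"
      by (metis image_image)
    also have "\<dots> = {W. openin (topology O') W}"
      unfolding op O'_def by blast
    finally show "(\<lambda>a. p ` h a) ` A = {W. openin (topology O') W}" .
  next
    fix a b assume ab: "a \<in> A" "b \<in> A"
    show "a \<le> b \<longleftrightarrow> p ` h a \<le> p ` h b"
      unfolding sub[OF oph[OF ab(1)] oph[OF ab(2)]] by (rule ord[OF ab])
  qed
  then show ?thesis
    unfolding spatial_def by blast
qed


section \<open>Nuclei\<close>

text \<open>\<open>nuclei\<close> carries the order of the function type, which is the pointwise one.\<close>

definition nuclei :: "('a::frame \<Rightarrow> 'a) set" where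
  "nuclei = {j. (\<forall>a. a \<le> j a) \<and> (\<forall>a. j (j a) \<le> j a) \<and> (\<forall>a b. j (inf a b) = inf (j a) (j b))}"


section \<open>The Esakia space and its nuclear points\<close>

definition prime_filter :: "'a::frame set \<Rightarrow> bool" where
  "prime_filter x \<longleftrightarrow>
     x \<noteq> {} \<and> x \<noteq> UNIV \<and>
     (\<forall>a b. a \<in> x \<longrightarrow> a \<le> b \<longrightarrow> b \<in> x) \<and>
     (\<forall>a b. a \<in> x \<longrightarrow> b \<in> x \<longrightarrow> inf a b \<in> x) \<and>
     (\<forall>a b. sup a b \<in> x \<longrightarrow> a \<in> x \<or> b \<in> x)"

definition esakia_points :: "'a::frame set set" where
  "esakia_points = {x. prime_filter x}"

definition esakia_phi :: "'a::frame \<Rightarrow> 'a set set" where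
  "esakia_phi a = {x \<in> esakia_points. a \<in> x}"

definition esakia_topology :: "'a::frame set topology" where
  "esakia_topology = topology_generated_by {esakia_phi a - esakia_phi b |a b. True}"

lemma topspace_esakia_topology: "topspace esakia_topology = esakia_points"
proof -
  have "esakia_phi top - esakia_phi bot = (esakia_points :: 'a set set)"
    by (auto simp: esakia_phi_def esakia_points_def prime_filter_def intro: top_greatest bot_least)
  then show ?thesis
    unfolding esakia_topology_def topology_generated_by_topspace
    by (fastforce simp: esakia_phi_def)
qed

definition esakia_down :: "'a::frame set set \<Rightarrow> 'a set set" where
  "esakia_down S = {x \<in> esakia_points. \<exists>s\<in>S. x \<subseteq> s}"

definition esakia_upset :: "'a::frame set set \<Rightarrow> bool" where
  "esakia_upset U \<longleftrightarrow> U \<subseteq> esakia_points \<and> (\<forall>x\<in>U. \<forall>y\<in>esakia_points. x \<subseteq> y \<longrightarrow> y \<in> U)"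

definition esakia_clopen :: "'a::frame set set \<Rightarrow> bool" where
  "esakia_clopen U \<longleftrightarrow> openin esakia_topology U \<and> closedin esakia_topology U"

definition nuclear :: "'a::frame set set \<Rightarrow> bool" where
  "nuclear F \<longleftrightarrow>
     closedin esakia_topology F \<and>
     (\<forall>U. esakia_clopen U \<longrightarrow> esakia_clopen (esakia_down (U \<inter> F)))"

definition nuclear_points :: "'a::frame set set" where
  "nuclear_points = {y \<in> esakia_points. nuclear {y}}"

definition open_upset_topology :: "'a::frame set topology" where
  "open_upset_topology = topology (\<lambda>U. openin esakia_topology U \<and> esakia_upset U)"

lemma openin_open_upset_topology:
  "openin open_upset_topology U \<longleftrightarrow> openin esakia_topology U \<and> esakia_upset U"
proof -
  have "istopology (\<lambda>U :: 'a set set. openin esakia_topology U \<and> esakia_upset U)"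
    unfolding istopology_def
  proof (intro conjI allI impI)
    fix S T :: "'a set set"
    assume "openin esakia_topology S \<and> esakia_upset S" "openin esakia_topology T \<and> esakia_upset T"
    then show "openin esakia_topology (S \<inter> T)" "esakia_upset (S \<inter> T)"
      by (auto simp: esakia_upset_def)
  next
    fix K :: "'a set set set"
    assume K: "\<forall>S\<in>K. openin esakia_topology S \<and> esakia_upset S"
    then show "openin esakia_topology (\<Union>K)"
      by (simp add: openin_Union)
    show "esakia_upset (\<Union>K)"
      using K unfolding esakia_upset_def by (meson Union_iff Union_least)
  qed
  then show ?thesis
    unfolding open_upset_topology_def by (simp add: topology_inverse')
qed

definition nuclear_topology :: "'a::frame set topology" where
  "nuclear_topology = subtopology open_upset_topology nuclear_points"

lemma topspace_nuclear_topology: "topspace nuclear_topology = nuclear_points"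
proof -
  have "openin open_upset_topology (esakia_points :: 'a set set)"
    using openin_topspace[of "esakia_topology :: 'a set topology"]
    by (simp add: openin_open_upset_topology esakia_upset_def topspace_esakia_topology)
  then have "(esakia_points :: 'a set set) \<subseteq> topspace open_upset_topology"
    by (rule openin_subset)
  then show ?thesis
    by (auto simp: nuclear_topology_def nuclear_points_def)
qed


section \<open>Weakly scattered spaces\<close>

definition weakly_isolated :: "'b topology \<Rightarrow> 'b set \<Rightarrow> 'b \<Rightarrow> bool" where
  "weakly_isolated S T x \<longleftrightarrow>
     x \<in> T \<and> (\<exists>U. openin S U \<and> x \<in> T \<inter> U \<and> T \<inter> U \<subseteq> S closure_of {x})"

definition weakly_scattered :: "'b topology \<Rightarrow> bool" where
  "weakly_scattered S \<longleftrightarrow> (\<forall>T. closedin S T \<and> T \<noteq> {} \<longrightarrow> (\<exists>x. weakly_isolated S T x))"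

end

theory Submission
  imports Defs
begin

text \<open>A point of the Esakia space is nuclear exactly when it is of the form \<open>{b. \<not> b \<le> p}\<close> for a
  meet-prime element \<open>p\<close> of the frame, and the \<open>\<tau>\<close>-closed sets are those of the points with \<open>a \<le> p\<close>
  for a fixed \<open>a\<close>. For a spatial frame, weak scatteredness therefore says that for every
  \<open>a \<noteq> top\<close> there is a factorisation \<open>inf u p \<le> a\<close> with \<open>p \<ge> a\<close> meet-prime and \<open>\<not> u \<le> p\<close>.
  The meet-prime nuclei are the two-valued nuclei \<open>prime_nucleus p\<close>, so spatiality of the frame of
  nuclei says that every fixed element of a nucleus \<open>j\<close> is a meet of fixed meet-primes of \<open>j\<close>. This
  yields the factorisation for \<open>a\<close> when applied to the double negation nucleus relative to \<open>a\<close>;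
  conversely, if \<open>b\<close> is the meet of the fixed meet-primes above a fixed \<open>a\<close>, a factorisation
  below \<open>b \<rightarrow> a\<close> would have its \<open>p\<close> fixed by \<open>j\<close>, which forces \<open>b \<rightarrow> a = top\<close>.\<close>

section \<open>Implication and meet-primes in a frame\<close>

text \<open>The frame law for a two-element set is distributivity over binary joins.\<close>

instance frame \<subseteq> distrib_lattice
proof
  fix x y z :: 'a
  have "inf a (sup b c) = sup (inf a b) (inf a c)" for a b c :: 'a
    using inf_Sup_frame[of a "{b, c}"] by simp
  then show "sup x (inf y z) = inf (sup x y) (sup x z)"
    by (rule distrib_imp1)
qed

text \<open>The Heyting implication, obtained as a join because a frame is given by its complete
  lattice structure alone.\<close>

definition frame_imp :: "'a::frame \<Rightarrow> 'a \<Rightarrow> 'a" where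
  "frame_imp a b = Sup {x. inf a x \<le> b}"

lemma le_frame_imp_iff: "x \<le> frame_imp a b \<longleftrightarrow> inf a x \<le> b"
proof
  assume "x \<le> frame_imp a b"
  then have "inf a x \<le> inf a (frame_imp a b)"
    by (rule inf_mono[OF order_refl])
  also have "\<dots> \<le> b"
    unfolding frame_imp_def inf_Sup_frame by (rule Sup_least) auto
  finally show "inf a x \<le> b" .
next
  assume "inf a x \<le> b"
  then show "x \<le> frame_imp a b"
    unfolding frame_imp_def by (intro Sup_upper) simp
qed

lemma inf_frame_imp_le: "inf a (frame_imp a b) \<le> b"
  using le_frame_imp_iff by blast

definition meet_prime :: "'a::frame \<Rightarrow> bool" where
  "meet_prime p \<longleftrightarrow> p \<noteq> top \<and> (\<forall>a b. inf a b \<le> p \<longrightarrow> a \<le> p \<or> b \<le> p)"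

text \<open>Choose a point \<open>s\<close> of the open set \<open>h i\<close> outside
  \<open>h j\<close> and let \<open>k\<close> correspond to the largest open set missing
  \<open>s\<close>; an element is below \<open>k\<close> exactly if its open set misses
  \<open>s\<close>. Primeness of \<open>k\<close> is phrased through common lower bounds in
  \<open>A\<close>, as \<open>A\<close> is merely an ordered set and its meets have no name.\<close>

lemma spatial_prime_separation:
  fixes A :: "'a::order set"
  assumes "spatial A" "i \<in> A" "j \<in> A" "\<not> i \<le> j"
  obtains k where "k \<in> A" "j \<le> k" "\<not> i \<le> k"
    "\<And>a b. a \<in> A \<Longrightarrow> b \<in> A \<Longrightarrow> (\<And>d. d \<in> A \<Longrightarrow> d \<le> a \<Longrightarrow> d \<le> b \<Longrightarrow> d \<le> k) \<Longrightarrow> a \<le> k \<or> b \<le> k"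
proof -
  obtain T :: "'a topology" and h where h: "order_iso h A {U. openin T U}"
    using assms(1) unfolding spatial_def by blast
  have ord: "a \<le> b \<longleftrightarrow> h a \<subseteq> h b" if "a \<in> A" "b \<in> A" for a b
    using h that by (auto simp: order_iso_def)
  have im: "h ` A = {U. openin T U}"
    using h by (auto simp: order_iso_def bij_betw_def)
  obtain s where s: "s \<in> h i" "s \<notin> h j"
    using assms ord by blast
  define P where "P = \<Union>{U. openin T U \<and> s \<notin> U}"
  have "openin T P"
    unfolding P_def by (rule openin_Union) auto
  then obtain k where k: "k \<in> A" "h k = P"
    using im by (metis imageE mem_Collect_eq)
  have le_k: "a \<le> k \<longleftrightarrow> s \<notin> h a" if "a \<in> A" for a
  proof -
    have "openin T (h a)"
      using im that by blast
    then show ?thesis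
      using ord[OF that k(1)] unfolding k(2) P_def by blast
  qed
  show ?thesis
  proof (rule that[OF k(1)])
    show "j \<le> k" "\<not> i \<le> k"
      using le_k assms s by blast+
    fix a b assume ab: "a \<in> A" "b \<in> A" and d: "\<And>d. d \<in> A \<Longrightarrow> d \<le> a \<Longrightarrow> d \<le> b \<Longrightarrow> d \<le> k"
    have "openin T (h a \<inter> h b)"
      using im ab by blast
    then obtain c where c: "c \<in> A" "h c = h a \<inter> h b"
      using im by (metis imageE mem_Collect_eq)
    then have "c \<le> k"
      using d ord ab by blast
    then show "a \<le> k \<or> b \<le> k"
      using le_k c ab by blast
  qed
qed

lemma meet_prime_separation:
  fixes a b :: "'a::frame"
  assumes "spatial (UNIV :: 'a set)" "\<not> a \<le> b"
  obtains p where "meet_prime p" "b \<le> p" "\<not> a \<le> p"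
proof -
  obtain p where p: "b \<le> p" "\<not> a \<le> p"
    "\<And>a b. (\<And>d. d \<le> a \<Longrightarrow> d \<le> b \<Longrightarrow> d \<le> p) \<Longrightarrow> a \<le> p \<or> b \<le> p"
    using spatial_prime_separation[OF assms(1) UNIV_I UNIV_I assms(2)] by (metis UNIV_I)
  have "meet_prime p"
    unfolding meet_prime_def
  proof (intro conjI allI impI)
    show "p \<noteq> top"
      using p(2) by auto
    fix a b assume "inf a b \<le> p"
    then show "a \<le> p \<or> b \<le> p"
      using p(3) by (meson le_inf_iff order_trans)
  qed
  with p show thesis
    using that by blast
qed


section \<open>Prime filters and open upsets\<close>

text \<open>The relation \<open>N\<close> is read as derivability of sequents, closed under cut. Taking it to be the order gives
  the prime filter theorem, taking it to be \<open>\<lambda>c d. esakia_phi c - esakia_phi d \<subseteq> U\<close> gives the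
  compactness of the Esakia space.\<close>

lemma prime_filter_exists:
  fixes N :: "'a::frame \<Rightarrow> 'a \<Rightarrow> bool"
  assumes refl: "\<And>c d. c \<le> d \<Longrightarrow> N c d"
    and mono: "\<And>c c' d d'. N c d \<Longrightarrow> c' \<le> c \<Longrightarrow> d \<le> d' \<Longrightarrow> N c' d'"
    and cut: "\<And>a c d. N (inf a c) d \<Longrightarrow> N c (sup a d) \<Longrightarrow> N c d"
    and con: "\<And>A B. finite A \<Longrightarrow> finite B \<Longrightarrow> A \<subseteq> F \<Longrightarrow> B \<subseteq> I \<Longrightarrow> \<not> N (Inf A) (Sup B)"
  obtains x where "prime_filter x" "F \<subseteq> x" "x \<inter> I = {}"
    "\<And>c d. c \<in> x \<Longrightarrow> d \<notin> x \<Longrightarrow> \<not> N c d"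
proof -
  \<comment> \<open>\<open>Inl a\<close> demands that \<open>a\<close> belong to the filter and
    \<open>Inr a\<close> that it stay outside. Coding both demands in one set lets Zorn's lemma for
    inclusion extend them together.\<close>
  define consistent where "consistent M \<longleftrightarrow>
    (\<forall>A B. finite A \<longrightarrow> finite B \<longrightarrow> Inl ` A \<union> Inr ` B \<subseteq> M \<longrightarrow> \<not> N (Inf A) (Sup B))" for M
  let ?M0 = "Inl ` F \<union> Inr ` I"
  define K where "K = {M. consistent M \<and> ?M0 \<subseteq> M}"
  have "\<exists>M\<in>K. \<forall>M'\<in>K. M \<subseteq> M' \<longrightarrow> M' = M"
  proof (rule subset_Zorn_nonempty)
    have "consistent ?M0"
      unfolding consistent_def
    proof (intro allI impI)
      fix A B assume "finite A" "finite B" and sub: "Inl ` A \<union> Inr ` B \<subseteq> ?M0"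
      moreover have "A \<subseteq> F" "B \<subseteq> I"
        using sub by auto
      ultimately show "\<not> N (Inf A) (Sup B)"
        using con by simp
    qed
    then show "K \<noteq> {}"
      by (auto simp: K_def)
  next
    fix C assume C: "C \<noteq> {}" "subset.chain K C"
    have "consistent (\<Union>C)"
      unfolding consistent_def
    proof (intro allI impI)
      fix A B assume fin: "finite A" "finite B" and sub: "Inl ` A \<union> Inr ` B \<subseteq> \<Union>C"
      have "finite (Inl ` A \<union> Inr ` B)"
        using fin by simp
      then obtain M where "M \<in> C" "Inl ` A \<union> Inr ` B \<subseteq> M"
        using finite_subset_Union_chain[OF _ sub C] by blast
      then show "\<not> N (Inf A) (Sup B)"
        using C(2) fin by (auto simp: subset_chain_def K_def consistent_def)
    qed
    moreover have "?M0 \<subseteq> \<Union>C"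
      using C unfolding subset_chain_def K_def by blast
    ultimately show "\<Union>C \<in> K"
      by (simp add: K_def)
  qed
  then obtain M where "M \<in> K" and max_K: "\<And>M'. M' \<in> K \<Longrightarrow> M \<subseteq> M' \<Longrightarrow> M' = M"
    by (elim bexE) metis
  then have M: "consistent M" "?M0 \<subseteq> M"
    by (simp_all add: K_def)
  have max: "M' = M" if "consistent M'" "M \<subseteq> M'" for M'
    by (rule max_K) (use that M in \<open>auto simp: K_def\<close>)
  have incon: "\<not> N (Inf A) (Sup B)" if "finite A" "finite B" "Inl ` A \<union> Inr ` B \<subseteq> M" for A B
    using M(1) that unfolding consistent_def by blast
  define x where "x = {a. Inl a \<in> M}"
  \<comment> \<open>Maximality decides every \<open>a\<close>: if neither demand could be added,
    each would produce a derivable sequent, and cutting \<open>a\<close> would make \<open>M\<close>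
    itself inconsistent.\<close>
  have compl: "Inr a \<in> M" if "a \<notin> x" for a
  proof (rule ccontr)
    assume nr: "Inr a \<notin> M"
    have nl: "Inl a \<notin> M"
      using that x_def by simp
    obtain A B where 1: "finite A" "finite B" "Inl ` A \<union> Inr ` B \<subseteq> insert (Inl a) M" "N (Inf A) (Sup B)"
      using max[of "insert (Inl a) M"] nl unfolding consistent_def by blast
    obtain A' B' where 2: "finite A'" "finite B'" "Inl ` A' \<union> Inr ` B' \<subseteq> insert (Inr a) M" "N (Inf A') (Sup B')"
      using max[of "insert (Inr a) M"] nr unfolding consistent_def by blast
    \<comment> \<open>All premises and all conclusions of the two sequents other than the cut
      element \<open>a\<close>.\<close>
    define c where "c = Inf ((A - {a}) \<union> A')"
    define d where "d = Sup (B \<union> (B' - {a}))"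
    have "inf a c \<le> Inf A"
      unfolding c_def by (rule Inf_greatest) (metis Inf_lower UnI1 insertE insert_Diff_single le_infI1 le_infI2 order_refl insertCI)
    moreover have "Sup B \<le> d"
      unfolding d_def by (intro Sup_subset_mono) auto
    ultimately have "N (inf a c) d"
      using 1(4) mono by blast
    moreover have "Sup B' \<le> sup a d"
      unfolding d_def by (rule Sup_least) (metis Sup_upper UnI2 insertE insert_Diff_single le_supI1 le_supI2 order_refl insertCI)
    moreover have "c \<le> Inf A'"
      unfolding c_def by (intro Inf_superset_mono) auto
    ultimately have "N c d"
      using 2(4) mono cut by blast
    moreover have "Inl ` ((A - {a}) \<union> A') \<union> Inr ` (B \<union> (B' - {a})) \<subseteq> M"
      using 1(3) 2(3) by blast
    moreover have "\<not> N c d" if "Inl ` ((A - {a}) \<union> A') \<union> Inr ` (B \<union> (B' - {a})) \<subseteq> M"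
      unfolding c_def d_def by (rule incon[OF _ _ that]) (simp_all add: 1 2)
    ultimately show False
      by simp
  qed
  have sep: "\<not> N c d" if "c \<in> x" "d \<notin> x" for c d
    using incon[of "{c}" "{d}"] compl[OF that(2)] that(1) by (simp add: x_def)
  have "prime_filter x"
    unfolding prime_filter_def
  proof (intro conjI allI impI)
    \<comment> \<open>The empty family of premises has meet \<open>top\<close>, so excluding
      \<open>top\<close> would contradict \<open>N top top\<close>.\<close>
    have "top \<in> x"
      using incon[of "{}" "{top}"] compl[of top] refl[of top top] by auto
    then show "x \<noteq> {}"
      by blast
    have "bot \<notin> x"
      using incon[of "{bot}" "{}"] refl[of bot bot] by (auto simp: x_def)
    then show "x \<noteq> UNIV"
      by blast
  next
    fix a b assume "a \<in> x" "a \<le> b"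
    then show "b \<in> x"
      using sep refl by blast
  next
    fix a b assume "a \<in> x" "b \<in> x"
    then show "inf a b \<in> x"
      using incon[of "{a, b}" "{inf a b}"] compl[of "inf a b"] refl[of "inf a b" "inf a b"]
      by (auto simp: x_def)
  next
    fix a b assume "sup a b \<in> x"
    then show "a \<in> x \<or> b \<in> x"
      using incon[of "{sup a b}" "{a, b}"] compl[of a] compl[of b] refl[of "sup a b" "sup a b"]
      by (auto simp: x_def)
  qed
  moreover have "F \<subseteq> x"
    using M(2) by (auto simp: x_def)
  moreover have "x \<inter> I = {}"
  proof -
    have "False" if "a \<in> x" "a \<in> I" for a
      using incon[of "{a}" "{a}"] refl[of a a] that M(2) by (auto simp: x_def)
    then show ?thesis by blast
  qed
  ultimately show thesis
    using sep that by blast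
qed

lemma prime_filter_separation:
  fixes a b :: "'a::frame"
  assumes "\<not> a \<le> b"
  obtains x where "prime_filter x" "a \<in> x" "b \<notin> x"
proof (rule prime_filter_exists[of "(\<le>)" "{a}" "{b}"])
  \<comment> \<open>For the order, the cut rule is distributivity.\<close>
  show "c \<le> d" if 1: "inf a c \<le> d" and 2: "c \<le> sup a d" for a c d :: 'a
  proof -
    have "c = inf c (sup a d)"
      using 2 by (simp add: inf_absorb1)
    also have "\<dots> = sup (inf c a) (inf c d)"
      by (rule inf_sup_distrib1)
    also have "\<dots> \<le> d"
      using 1 by (simp add: inf_commute)
    finally show ?thesis .
  qed
  show "\<not> Inf A \<le> Sup B" if "A \<subseteq> {a}" "B \<subseteq> {b}" for A B
    using assms that by (metis Inf_superset_mono Sup_subset_mono ccpo_Sup_singleton cInf_singleton order_trans)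
next
  show "c' \<le> d'" if "c \<le> d" "c' \<le> c" "d \<le> d'" for c c' d d' :: 'a
    using that by (meson order_trans)
  show thesis if "prime_filter x" "{a} \<subseteq> x" "x \<inter> {b} = {}" for x
    using that \<open>\<And>x. prime_filter x \<Longrightarrow> a \<in> x \<Longrightarrow> b \<notin> x \<Longrightarrow> thesis\<close> by simp
qed

section \<open>Elementary properties of prime filters\<close>

lemma prime_filter_upward: "prime_filter x \<Longrightarrow> a \<in> x \<Longrightarrow> a \<le> b \<Longrightarrow> b \<in> x"
  by (auto simp: prime_filter_def)

lemma prime_filter_inf_iff: "prime_filter x \<Longrightarrow> inf a b \<in> x \<longleftrightarrow> a \<in> x \<and> b \<in> x"
  by (meson inf.cobounded1 inf.cobounded2 prime_filter_def)

lemma prime_filter_sup_iff: "prime_filter x \<Longrightarrow> sup a b \<in> x \<longleftrightarrow> a \<in> x \<or> b \<in> x"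
  by (meson sup.cobounded1 sup.cobounded2 prime_filter_def)

lemma prime_filter_top: "prime_filter x \<Longrightarrow> top \<in> x"
  unfolding prime_filter_def by (metis ex_in_conv top_greatest)

lemma prime_filter_bot: "prime_filter x \<Longrightarrow> bot \<notin> x"
  unfolding prime_filter_def by (metis UNIV_eq_I bot_least)

lemma prime_filter_Inf:
  assumes "prime_filter x" "finite A" "A \<subseteq> x"
  shows "Inf A \<in> x"
  using assms(2,3)
  by (induction A rule: finite_induct) (simp_all add: assms(1) prime_filter_top prime_filter_inf_iff)

section \<open>Open sets and open upsets of the Esakia space\<close>

lemma openin_esakia_basic: "openin esakia_topology (esakia_phi c - esakia_phi d)"
  unfolding esakia_topology_def by (rule topology_generated_by_Basis) blast

text \<open>The generating sets form a basis: intersecting two of them amounts to taking the meet of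
  the first elements and the join of the second ones.\<close>

lemma openin_esakia_topology_iff:
  "openin esakia_topology U \<longleftrightarrow> U \<subseteq> esakia_points \<and>
     (\<forall>x\<in>U. \<exists>c d. c \<in> x \<and> d \<notin> x \<and> esakia_phi c - esakia_phi d \<subseteq> U)"
  (is "_ \<longleftrightarrow> ?basic U")
proof
  assume "openin esakia_topology U"
  then have "generate_topology_on {esakia_phi a - esakia_phi b |a b. True} U"
    unfolding esakia_topology_def openin_topology_generated_by_iff .
  then show "?basic U"
  proof induction
    case Empty
    then show ?case by simp
  next
    case (Int S T)
    show ?case
    proof (intro conjI ballI)
      show "S \<inter> T \<subseteq> esakia_points"
        using Int by blast
      fix x assume x: "x \<in> S \<inter> T"
      then have pf: "prime_filter x"
        using Int by (auto simp: esakia_points_def)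
      obtain c d where S: "c \<in> x" "d \<notin> x" "esakia_phi c - esakia_phi d \<subseteq> S"
        using Int.IH(1) x by (meson IntD1)
      obtain c' d' where T: "c' \<in> x" "d' \<notin> x" "esakia_phi c' - esakia_phi d' \<subseteq> T"
        using Int.IH(2) x by (meson IntD2)
      have "esakia_phi (inf c c') - esakia_phi (sup d d') \<subseteq> S \<inter> T"
        using S(3) T(3)
        by (auto simp: esakia_phi_def esakia_points_def prime_filter_inf_iff prime_filter_sup_iff subset_iff)
      moreover have "inf c c' \<in> x" "sup d d' \<notin> x"
        using S T pf by (auto simp: prime_filter_inf_iff prime_filter_sup_iff)
      ultimately show "\<exists>c d. c \<in> x \<and> d \<notin> x \<and> esakia_phi c - esakia_phi d \<subseteq> S \<inter> T"
        by blast
    qed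
  next
    case (UN K)
    then show ?case
      by (meson Sup_least UnionE Union_upper subset_trans)
  next
    case (Basis S)
    then show ?case
      by (fastforce simp: esakia_phi_def)
  qed
next
  assume U: "?basic U"
  show "openin esakia_topology U"
  proof (subst openin_subopen, intro ballI)
    fix x assume x: "x \<in> U"
    then obtain c d where cd: "c \<in> x" "d \<notin> x" "esakia_phi c - esakia_phi d \<subseteq> U"
      using U by meson
    moreover have "x \<in> esakia_phi c - esakia_phi d"
      using U x cd(1,2) by (simp add: esakia_phi_def subset_iff)
    ultimately show "\<exists>T. openin esakia_topology T \<and> x \<in> T \<and> T \<subseteq> U"
      using openin_esakia_basic by meson
  qed
qed

lemma esakia_phi_bot: "esakia_phi bot = {}"
  by (auto simp: esakia_phi_def esakia_points_def dest: prime_filter_bot)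

lemma esakia_phi_top: "esakia_phi top = esakia_points"
  by (auto simp: esakia_phi_def esakia_points_def dest: prime_filter_top)

lemma openin_esakia_phi: "openin esakia_topology (esakia_phi a)"
  using openin_esakia_basic[of a bot] by (simp add: esakia_phi_bot)

lemma closedin_esakia_phi: "closedin esakia_topology (esakia_phi a)"
  unfolding closedin_def topspace_esakia_topology
  using openin_esakia_basic[of top a] unfolding esakia_phi_top by (auto simp: esakia_phi_def)

lemma esakia_upset_phi: "esakia_upset (esakia_phi a)"
  by (auto simp: esakia_upset_def esakia_phi_def)

text \<open>A compactness argument. If no \<open>b\<close> in \<open>x\<close> worked, some prime
  filter \<open>z\<close> extending \<open>x\<close> would have no basic neighbourhood inside
  \<open>U\<close>, although \<open>z\<close> lies in the open upset \<open>U\<close>.\<close>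

lemma open_upset_contains_phi:
  assumes U: "openin esakia_topology U" "esakia_upset U" and x: "x \<in> U"
  obtains b where "b \<in> x" "esakia_phi b \<subseteq> U"
proof (rule ccontr)
  assume "\<not> thesis"
  then have no: "\<not> esakia_phi b \<subseteq> U" if "b \<in> x" for b
    using that \<open>\<And>b. b \<in> x \<Longrightarrow> esakia_phi b \<subseteq> U \<Longrightarrow> thesis\<close> by blast
  have pf: "prime_filter x"
    using U(2) x by (auto simp: esakia_upset_def esakia_points_def)
  obtain z where z: "prime_filter z" "x \<subseteq> z"
    "\<And>c d. c \<in> z \<Longrightarrow> d \<notin> z \<Longrightarrow> \<not> esakia_phi c - esakia_phi d \<subseteq> U"
  proof (rule prime_filter_exists[of "\<lambda>c d. esakia_phi c - esakia_phi d \<subseteq> U" x "{}"])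
    show "\<not> esakia_phi (Inf A) - esakia_phi (Sup B) \<subseteq> U"
      if "finite A" "A \<subseteq> x" "B \<subseteq> {}" for A B
      using no[OF prime_filter_Inf[OF pf that(1,2)]] that(3) by (simp add: esakia_phi_bot)
    show "esakia_phi c - esakia_phi d \<subseteq> U" if "c \<le> d" for c d
      using that by (auto simp: esakia_phi_def esakia_points_def dest: prime_filter_upward)
    show "esakia_phi c' - esakia_phi d' \<subseteq> U"
      if "esakia_phi c - esakia_phi d \<subseteq> U" "c' \<le> c" "d \<le> d'" for c c' d d'
      using that by (fastforce simp: esakia_phi_def esakia_points_def dest: prime_filter_upward)
    show "esakia_phi c - esakia_phi d \<subseteq> U"
      if "esakia_phi (inf a c) - esakia_phi d \<subseteq> U" "esakia_phi c - esakia_phi (sup a d) \<subseteq> U" for a c d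
      using that
      by (auto simp: esakia_phi_def esakia_points_def prime_filter_inf_iff prime_filter_sup_iff subset_iff)
  qed blast
  then have "z \<in> U"
    using U(2) x by (auto simp: esakia_upset_def esakia_points_def)
  then obtain c d where "c \<in> z" "d \<notin> z" "esakia_phi c - esakia_phi d \<subseteq> U"
    using U(1) unfolding openin_esakia_topology_iff by meson
  then show False
    using z(3) by simp
qed


section \<open>The space of nuclear points\<close>

text \<open>The complement of the principal ideal of \<open>p\<close>. Larger \<open>p\<close> give
  smaller filters, so the order is reversed.\<close>

definition prime_point :: "'a::frame \<Rightarrow> 'a set" where
  "prime_point p = {b. \<not> b \<le> p}"

lemma mem_prime_point_iff [simp]: "b \<in> prime_point p \<longleftrightarrow> \<not> b \<le> p"
  by (simp add: prime_point_def)

lemma prime_filter_prime_point: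
  assumes "meet_prime p"
  shows "prime_filter (prime_point p)"
  unfolding prime_filter_def
proof (intro conjI allI impI)
  have "top \<in> prime_point p" "bot \<notin> prime_point p"
    using assms by (auto simp: meet_prime_def top_unique)
  then show "prime_point p \<noteq> {}" "prime_point p \<noteq> UNIV"
    by blast+
next
  fix a b assume "a \<in> prime_point p" "a \<le> b"
  then show "b \<in> prime_point p"
    using order_trans[of a b p] by simp
qed (use assms in \<open>simp_all add: meet_prime_def, blast\<close>)

lemma prime_point_subset_iff: "prime_point p \<subseteq> prime_point q \<longleftrightarrow> q \<le> p"
  unfolding prime_point_def subset_iff mem_Collect_eq by (meson order_refl order_trans)

lemma closedin_esakia_singleton:
  assumes "y \<in> esakia_points"
  shows "closedin esakia_topology {y}"
  unfolding closedin_def topspace_esakia_topology openin_esakia_topology_iff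
proof (intro conjI ballI)
  fix x assume x: "x \<in> esakia_points - {y}"
  then have pf: "prime_filter x"
    by (simp add: esakia_points_def)
  consider b where "b \<in> x" "b \<notin> y" | b where "b \<notin> x" "b \<in> y"
    using x by blast
  then show "\<exists>c d. c \<in> x \<and> d \<notin> x \<and> esakia_phi c - esakia_phi d \<subseteq> esakia_points - {y}"
  proof cases
    case 1
    then have "esakia_phi b - esakia_phi bot \<subseteq> esakia_points - {y}"
      by (auto simp: esakia_phi_def)
    then show ?thesis
      using 1 prime_filter_bot[OF pf] by blast
  next
    case 2
    then have "esakia_phi top - esakia_phi b \<subseteq> esakia_points - {y}"
      by (auto simp: esakia_phi_def)
    then show ?thesis
      using 2 prime_filter_top[OF pf] by blast
  qed
qed (use assms in simp_all)

text \<open>The downset of this point is the complement of \<open>esakia_phi p\<close>, hence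
  clopen, and a clopen set meets a singleton in nothing or in all of it.\<close>

lemma nuclear_prime_point:
  assumes "meet_prime p"
  shows "prime_point p \<in> nuclear_points"
proof -
  have pt: "prime_point p \<in> esakia_points"
    using prime_filter_prime_point[OF assms] by (simp add: esakia_points_def)
  have down: "esakia_down {prime_point p} = esakia_points - esakia_phi p"
    by (auto simp: esakia_down_def esakia_phi_def esakia_points_def dest: prime_filter_upward)
  have "esakia_clopen (esakia_points - esakia_phi p)"
    unfolding esakia_clopen_def
    by (metis openin_esakia_phi closedin_esakia_phi closedin_diff closedin_topspace openin_diff
        openin_topspace topspace_esakia_topology)
  moreover have "esakia_clopen (esakia_down {})"
    by (simp add: esakia_clopen_def esakia_down_def)
  moreover have "U \<inter> {prime_point p} = {} \<or> U \<inter> {prime_point p} = {prime_point p}" for U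
    by blast
  ultimately have "esakia_clopen (esakia_down (U \<inter> {prime_point p}))" for U
    using down by metis
  then show ?thesis
    using pt closedin_esakia_singleton[OF pt] by (simp add: nuclear_points_def nuclear_def)
qed

text \<open>A basic neighbourhood \<open>esakia_phi c - esakia_phi d\<close> of \<open>y\<close> inside the downset of \<open>y\<close> bounds all
  elements outside \<open>y\<close> by \<open>c \<rightarrow> d\<close>, hence also their join.\<close>

lemma nuclear_imp_prime_point:
  assumes "y \<in> nuclear_points"
  obtains p where "meet_prime p" "y = prime_point p"
proof -
  have y: "y \<in> esakia_points" "prime_filter y"
    using assms by (auto simp: nuclear_points_def esakia_points_def)
  \<comment> \<open>Nuclearity is applied to the whole space, so that the downset of
    \<open>y\<close> becomes open.\<close>
  have "esakia_clopen (topspace esakia_topology)"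
    by (simp add: esakia_clopen_def)
  then have "esakia_clopen (esakia_down (topspace esakia_topology \<inter> {y}))"
    using assms unfolding nuclear_points_def nuclear_def by blast
  then have "openin esakia_topology (esakia_down {y})"
    using y by (simp add: esakia_clopen_def topspace_esakia_topology)
  moreover have "y \<in> esakia_down {y}"
    using y by (simp add: esakia_down_def)
  ultimately obtain c d where cd: "c \<in> y" "d \<notin> y" "esakia_phi c - esakia_phi d \<subseteq> esakia_down {y}"
    unfolding openin_esakia_topology_iff by blast
  \<comment> \<open>Otherwise a prime filter containing \<open>inf c b\<close> but not
    \<open>d\<close> lies in the neighbourhood, hence inside \<open>y\<close>, and carries
    \<open>b\<close> into \<open>y\<close>.\<close>
  have out: "b \<le> frame_imp c d" if "b \<notin> y" for b
  proof (rule ccontr)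
    assume "\<not> b \<le> frame_imp c d"
    then obtain x where x: "prime_filter x" "inf c b \<in> x" "d \<notin> x"
      unfolding le_frame_imp_iff using prime_filter_separation by blast
    then have "x \<in> esakia_phi c - esakia_phi d"
      by (auto simp: esakia_phi_def esakia_points_def prime_filter_inf_iff)
    then have "x \<subseteq> y"
      using cd(3) by (auto simp: esakia_down_def)
    then show False
      using that x prime_filter_inf_iff by blast
  qed
  define p where "p = Sup (- y)"
  have "p \<le> frame_imp c d"
    unfolding p_def by (rule Sup_least) (use out in auto)
  then have "inf c p \<le> d"
    by (simp add: le_frame_imp_iff)
  then have p: "p \<notin> y"
    using cd(1,2) y(2) prime_filter_inf_iff prime_filter_upward by blast
  have iff: "b \<in> y \<longleftrightarrow> \<not> b \<le> p" for b
    using p y(2) prime_filter_upward unfolding p_def by (metis ComplI Sup_upper)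
  have "meet_prime p"
    unfolding meet_prime_def
  proof (intro conjI allI impI)
    show "p \<noteq> top"
      using p prime_filter_top[OF y(2)] by blast
    fix a b assume "inf a b \<le> p"
    then show "a \<le> p \<or> b \<le> p"
      using iff prime_filter_inf_iff[OF y(2)] by blast
  qed
  then show thesis
    using that iff by (auto simp: prime_point_def)
qed

lemma nuclear_points_eq: "nuclear_points = prime_point ` Collect meet_prime"
  using nuclear_prime_point nuclear_imp_prime_point by blast

lemma prime_point_in_phi_iff: "meet_prime p \<Longrightarrow> prime_point p \<in> esakia_phi a \<longleftrightarrow> \<not> a \<le> p"
  by (simp add: esakia_phi_def esakia_points_def prime_filter_prime_point)

text \<open>An open upset is a union of sets \<open>esakia_phi b\<close>. On nuclear points this
  union is the trace of \<open>esakia_phi a\<close> for the join \<open>a\<close> of these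
  \<open>b\<close>, since a join fails to be below \<open>p\<close> exactly if one of its members
  does.\<close>

lemma openin_nuclear_topology_iff:
  "openin nuclear_topology W \<longleftrightarrow> (\<exists>a. W = prime_point ` {p. meet_prime p \<and> \<not> a \<le> p})"
proof
  assume "openin nuclear_topology W"
  then obtain U where U: "openin esakia_topology U" "esakia_upset U" "W = U \<inter> nuclear_points"
    by (auto simp: nuclear_topology_def openin_subtopology openin_open_upset_topology)
  define a where "a = Sup {b. esakia_phi b \<subseteq> U}"
  have "prime_point p \<in> U \<longleftrightarrow> \<not> a \<le> p" if p: "meet_prime p" for p
  proof
    assume "prime_point p \<in> U"
    then obtain b where "b \<in> prime_point p" "esakia_phi b \<subseteq> U"
      using open_upset_contains_phi[OF U(1,2)] by blast
    moreover from this have "b \<le> a"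
      unfolding a_def by (intro Sup_upper) simp
    ultimately show "\<not> a \<le> p"
      by auto
  next
    assume "\<not> a \<le> p"
    then obtain b where "esakia_phi b \<subseteq> U" "\<not> b \<le> p"
      unfolding a_def Sup_le_iff by blast
    then show "prime_point p \<in> U"
      using prime_point_in_phi_iff[OF p] by blast
  qed
  then have "W = prime_point ` {p. meet_prime p \<and> \<not> a \<le> p}"
    unfolding U(3) nuclear_points_eq by blast
  then show "\<exists>a. W = prime_point ` {p. meet_prime p \<and> \<not> a \<le> p}" ..
next
  assume "\<exists>a. W = prime_point ` {p. meet_prime p \<and> \<not> a \<le> p}"
  then obtain a where a: "W = prime_point ` {p. meet_prime p \<and> \<not> a \<le> p}" ..
  have "W = esakia_phi a \<inter> nuclear_points"
    unfolding a nuclear_points_eq by (auto simp: prime_point_in_phi_iff)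
  then show "openin nuclear_topology W"
    unfolding nuclear_topology_def openin_subtopology openin_open_upset_topology
    using openin_esakia_phi esakia_upset_phi by blast
qed

lemma prime_point_eq_iff: "prime_point p = prime_point q \<longleftrightarrow> p = q"
  using prime_point_subset_iff by (metis order_antisym order_refl)

lemma closedin_nuclear_topology_iff:
  "closedin nuclear_topology W \<longleftrightarrow> (\<exists>a. W = prime_point ` {p. meet_prime p \<and> a \<le> p})"
proof -
  have *: "nuclear_points - prime_point ` {p. meet_prime p \<and> P p} = prime_point ` {p. meet_prime p \<and> \<not> P p}"
    for P :: "'a \<Rightarrow> bool"
    unfolding nuclear_points_eq by (auto simp: prime_point_eq_iff)
  have "W \<subseteq> nuclear_points \<and> nuclear_points - W = prime_point ` {p. meet_prime p \<and> \<not> a \<le> p}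
      \<longleftrightarrow> W = prime_point ` {p. meet_prime p \<and> a \<le> p}" for a
  proof
    assume "W \<subseteq> nuclear_points \<and> nuclear_points - W = prime_point ` {p. meet_prime p \<and> \<not> a \<le> p}"
    then have "W = nuclear_points - prime_point ` {p. meet_prime p \<and> \<not> a \<le> p}"
      by blast
    then show "W = prime_point ` {p. meet_prime p \<and> a \<le> p}"
      using *[of "\<lambda>p. \<not> a \<le> p"] by simp
  next
    assume "W = prime_point ` {p. meet_prime p \<and> a \<le> p}"
    then show "W \<subseteq> nuclear_points \<and> nuclear_points - W = prime_point ` {p. meet_prime p \<and> \<not> a \<le> p}"
      using *[of "\<lambda>p. a \<le> p"] by (auto simp: nuclear_prime_point)
  qed
  then show ?thesis
    unfolding closedin_def topspace_nuclear_topology openin_nuclear_topology_iff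
    by (simp only: ex_simps[symmetric])
qed

text \<open>The points above \<open>p\<close> form the least closed set containing the point of
  \<open>p\<close>.\<close>

lemma closure_of_prime_point:
  assumes p: "meet_prime p" and q: "meet_prime q"
  shows "prime_point q \<in> nuclear_topology closure_of {prime_point p} \<longleftrightarrow> p \<le> q"
proof
  assume q_in: "prime_point q \<in> nuclear_topology closure_of {prime_point p}"
  have "closedin nuclear_topology (prime_point ` {q. meet_prime q \<and> p \<le> q})"
    using closedin_nuclear_topology_iff by blast
  moreover have "{prime_point p} \<subseteq> prime_point ` {q. meet_prime q \<and> p \<le> q}"
    using p by blast
  ultimately have "prime_point q \<in> prime_point ` {q. meet_prime q \<and> p \<le> q}"
    using subsetD[OF closure_of_minimal q_in] by simp
  then show "p \<le> q"
    by (auto simp: prime_point_eq_iff)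
next
  assume "p \<le> q"
  then show "prime_point q \<in> nuclear_topology closure_of {prime_point p}"
    unfolding in_closure_of topspace_nuclear_topology openin_nuclear_topology_iff
    using p q order_trans[of _ p q] by (auto simp: nuclear_prime_point prime_point_eq_iff)
qed

text \<open>Spatiality of the frame turns the inclusion \<open>T \<inter> U \<subseteq> S closure_of {x}\<close> in the definition of weakly
  isolated points into the inequality \<open>inf u p \<le> a\<close>.\<close>

lemma weakly_scattered_iff:
  assumes sp: "spatial (UNIV :: 'a::frame set)"
  shows "weakly_scattered (nuclear_topology :: 'a set topology) \<longleftrightarrow>
    (\<forall>a::'a. a \<noteq> top \<longrightarrow> (\<exists>p u. meet_prime p \<and> a \<le> p \<and> \<not> u \<le> p \<and> inf u p \<le> a))"
proof -
  let ?V = "\<lambda>a::'a. prime_point ` {p. meet_prime p \<and> a \<le> p}"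
  let ?W = "\<lambda>u::'a. prime_point ` {p. meet_prime p \<and> \<not> u \<le> p}"
  have ne: "?V a \<noteq> {} \<longleftrightarrow> a \<noteq> top" for a
  proof
    assume "a \<noteq> top"
    then have "\<not> top \<le> a"
      by (simp add: top_unique)
    then show "?V a \<noteq> {}"
      using meet_prime_separation[OF sp] by blast
  qed (auto simp: meet_prime_def top_unique)
  have inf_le: "inf u p \<le> a \<longleftrightarrow> (\<forall>q. meet_prime q \<and> a \<le> q \<and> \<not> u \<le> q \<longrightarrow> p \<le> q)" (is "?l \<longleftrightarrow> ?r")
    for u p a :: 'a
  proof
    assume ?l
    then show ?r
      unfolding meet_prime_def by (meson order_trans)
  next
    assume r: ?r
    show ?l
    proof (rule ccontr)
      assume "\<not> inf u p \<le> a"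
      then obtain q where "meet_prime q" "a \<le> q" "\<not> inf u p \<le> q"
        using meet_prime_separation[OF sp] by blast
      then show False
        using r by (meson inf.coboundedI1 inf.coboundedI2)
    qed
  qed
  have inter: "?V a \<inter> ?W u = prime_point ` {p. meet_prime p \<and> a \<le> p \<and> \<not> u \<le> p}" for a u
    by (auto simp: prime_point_eq_iff)
  have "(\<exists>x. weakly_isolated nuclear_topology (?V a) x) \<longleftrightarrow>
    (\<exists>p u. meet_prime p \<and> a \<le> p \<and> \<not> u \<le> p \<and> inf u p \<le> a)" for a
  proof -
    have 1: "inf u p \<le> a \<longleftrightarrow> ?V a \<inter> ?W u \<subseteq> nuclear_topology closure_of {prime_point p}"
      if "meet_prime p" for p u
      unfolding inf_le inter using that by (auto simp: closure_of_prime_point)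
    have 2: "prime_point p \<in> ?V a \<inter> ?W u \<longleftrightarrow> meet_prime p \<and> a \<le> p \<and> \<not> u \<le> p" for p u
      unfolding inter by (auto simp: prime_point_eq_iff)
    have "(\<exists>x. weakly_isolated nuclear_topology (?V a) x) \<longleftrightarrow>
      (\<exists>p u. prime_point p \<in> ?V a \<inter> ?W u \<and> ?V a \<inter> ?W u \<subseteq> nuclear_topology closure_of {prime_point p})"
      unfolding weakly_isolated_def openin_nuclear_topology_iff by blast
    also have "\<dots> \<longleftrightarrow> (\<exists>p u. meet_prime p \<and> a \<le> p \<and> \<not> u \<le> p \<and> inf u p \<le> a)"
      unfolding 2 using 1 by meson
    finally show ?thesis .
  qed
  moreover have "weakly_scattered (nuclear_topology :: 'a set topology) \<longleftrightarrow>
    (\<forall>a. ?V a \<noteq> {} \<longrightarrow> (\<exists>x. weakly_isolated nuclear_topology (?V a) x))"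
    unfolding weakly_scattered_def closedin_nuclear_topology_iff by blast
  ultimately show ?thesis
    by (simp only: ne)
qed


section \<open>Meet-prime nuclei\<close>

lemma nuclei_increasing: "j \<in> nuclei \<Longrightarrow> a \<le> j a"
  and nuclei_idem: "j \<in> nuclei \<Longrightarrow> j (j a) = j a"
  and nuclei_inf: "j \<in> nuclei \<Longrightarrow> j (inf a b) = inf (j a) (j b)"
  by (auto simp: nuclei_def intro: order_antisym)

lemma nuclei_mono: "j \<in> nuclei \<Longrightarrow> a \<le> b \<Longrightarrow> j a \<le> j b"
  by (metis nuclei_inf inf.absorb_iff1)

text \<open>Since \<open>a \<le> j a\<close>, the meet of \<open>a\<close> with
  \<open>j (frame_imp a b)\<close> is below \<open>j (inf a (frame_imp a b))\<close>, and this is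
  below \<open>j b = b\<close>.\<close>

lemma nuclei_frame_imp_fixed:
  assumes j: "j \<in> nuclei" and b: "j b = b"
  shows "j (frame_imp a b) = frame_imp a b"
proof (rule order_antisym)
  have "inf a (j (frame_imp a b)) \<le> inf (j a) (j (frame_imp a b))"
    using nuclei_increasing[OF j] by (intro inf_mono) auto
  also have "\<dots> \<le> j b"
    using nuclei_mono[OF j inf_frame_imp_le] nuclei_inf[OF j] by metis
  finally show "j (frame_imp a b) \<le> frame_imp a b"
    by (simp add: b le_frame_imp_iff)
qed (rule nuclei_increasing[OF j])

section \<open>Closed, open and double negation nuclei\<close>

lemma nuclei_sup: "sup a \<in> nuclei"
  by (auto simp: nuclei_def sup_inf_distrib1)

lemma frame_imp_inf: "frame_imp a (inf x y) = inf (frame_imp a x) (frame_imp a y)"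
proof (rule order_antisym)
  show "frame_imp a (inf x y) \<le> inf (frame_imp a x) (frame_imp a y)"
    using inf_frame_imp_le[of a "inf x y"] by (simp add: le_frame_imp_iff)
  have "inf a (inf (frame_imp a x) (frame_imp a y)) \<le> x"
    by (rule order_trans[OF inf_mono[OF order_refl inf_le1] inf_frame_imp_le])
  moreover have "inf a (inf (frame_imp a x) (frame_imp a y)) \<le> y"
    by (rule order_trans[OF inf_mono[OF order_refl inf_le2] inf_frame_imp_le])
  ultimately show "inf (frame_imp a x) (frame_imp a y) \<le> frame_imp a (inf x y)"
    by (simp add: le_frame_imp_iff)
qed

lemma nuclei_frame_imp: "frame_imp a \<in> nuclei"
proof -
  have "inf a x = inf a (inf a x)" for x
    by simp
  moreover have "inf a (frame_imp a (frame_imp a x)) \<le> frame_imp a x" for x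
    by (rule inf_frame_imp_le)
  ultimately have "frame_imp a (frame_imp a x) \<le> frame_imp a x" for x
    by (metis le_frame_imp_iff)
  then show ?thesis
    by (simp add: nuclei_def frame_imp_inf le_frame_imp_iff)
qed

lemma frame_imp_antimono: "x \<le> y \<Longrightarrow> frame_imp y a \<le> frame_imp x a"
  unfolding le_frame_imp_iff by (meson inf_frame_imp_le inf_mono order_refl order_trans)

lemma nuclei_double_negation: "(\<lambda>x. frame_imp (frame_imp x a) a) \<in> nuclei"
proof -
  let ?n = "\<lambda>x. frame_imp x a"
  have inc: "x \<le> ?n (?n x)" for x
    using inf_frame_imp_le[of x a] by (simp add: le_frame_imp_iff inf_commute)
  have triple: "?n (?n (?n x)) = ?n x" for x
    using inc frame_imp_antimono by (metis order_antisym)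
  have inf_le: "inf (?n (?n x)) (?n (?n y)) \<le> ?n (?n (inf x y))" for x y
  proof -
    \<comment> \<open>From \<open>inf x (inf y ?w) \<le> a\<close>, first \<open>x\<close> and then
      \<open>y\<close> is replaced by its double negation, each time by moving it across the
      implication.\<close>
    let ?w = "?n (inf x y)" and ?z = "inf (?n (?n x)) (?n (?n y))"
    have "inf x (inf y ?w) \<le> a"
      using inf_frame_imp_le[of "inf x y" a] by (simp add: inf_assoc)
    then have "inf y ?w \<le> ?n x"
      by (simp add: le_frame_imp_iff)
    then have "inf (inf y ?w) (?n (?n x)) \<le> inf (?n x) (?n (?n x))"
      by (rule inf_mono) simp
    then have "inf (inf y ?w) (?n (?n x)) \<le> a"
      using inf_frame_imp_le order_trans by blast
    then have "inf ?w (?n (?n x)) \<le> ?n y"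
      by (simp add: le_frame_imp_iff inf_assoc)
    then have "inf (inf ?w (?n (?n x))) (?n (?n y)) \<le> inf (?n y) (?n (?n y))"
      by (rule inf_mono) simp
    then have "inf (inf ?w (?n (?n x))) (?n (?n y)) \<le> a"
      using inf_frame_imp_le order_trans by blast
    then show ?thesis
      by (simp add: le_frame_imp_iff inf_assoc)
  qed
  have "?n (?n (inf x y)) = inf (?n (?n x)) (?n (?n y))" for x y
    using inf_le by (intro order_antisym) (auto intro!: frame_imp_antimono)
  then show ?thesis
    unfolding nuclei_def using inc triple by (simp add: order_refl)
qed

text \<open>For meet-prime \<open>p\<close>, the largest nucleus fixing \<open>p\<close>; its only
  fixed elements are \<open>p\<close> and \<open>top\<close>.\<close>

definition prime_nucleus :: "'a::frame \<Rightarrow> 'a \<Rightarrow> 'a" where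
  "prime_nucleus p x = (if x \<le> p then p else top)"

lemma nuclei_prime_nucleus:
  assumes "meet_prime p"
  shows "prime_nucleus p \<in> nuclei"
  using assms unfolding nuclei_def prime_nucleus_def meet_prime_def
  by (auto simp: inf.coboundedI1 inf.coboundedI2)

lemma nuclei_le_prime_nucleus: "j \<in> nuclei \<Longrightarrow> j p = p \<Longrightarrow> j \<le> prime_nucleus p"
  using nuclei_mono by (fastforce simp: le_fun_def prime_nucleus_def)

text \<open>Meets of nuclei are pointwise; joins are then available as meets of upper
  bounds.\<close>

lemma nuclei_Inf:
  assumes "K \<subseteq> nuclei"
  shows "Inf K \<in> nuclei"
proof -
  have "Inf K (Inf K a) \<le> k a" if "k \<in> K" for k a
  proof -
    have "Inf K x \<le> k x" for x
      using that by (auto intro: INF_lower)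
    then have "Inf K (Inf K a) \<le> k (k a)"
      using nuclei_mono that assms by (meson order_trans subset_iff)
    then show ?thesis
      using nuclei_idem that assms by (metis subset_iff)
  qed
  then have "Inf K (Inf K a) \<le> (INF k\<in>K. k a)" for a
    by (rule INF_greatest)
  then have "Inf K (Inf K a) \<le> Inf K a" for a
    by (simp only: Inf_apply)
  moreover have "a \<le> Inf K a" for a
    using assms nuclei_increasing by (auto intro!: INF_greatest)
  moreover have "Inf K (inf a b) = inf (Inf K a) (Inf K b)" for a b
  proof -
    have "Inf K (inf a b) = (INF k\<in>K. inf (k a) (k b))"
      unfolding Inf_apply using assms nuclei_inf by (intro INF_cong) auto
    then show ?thesis
      by (simp add: INF_inf_distrib)
  qed
  ultimately show ?thesis
    by (simp add: nuclei_def)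
qed

text \<open>The nuclei \<open>sup a\<close> and \<open>frame_imp a\<close> are complementary, so a meet-prime nucleus \<open>k\<close> lies above one
  of them; hence it takes only the values \<open>k bot\<close> and \<open>top\<close>.\<close>

lemma fixed_meet_prime_above:
  fixes j :: "'a::frame \<Rightarrow> 'a"
  assumes sp: "spatial (nuclei :: ('a \<Rightarrow> 'a) set)" and j: "j \<in> nuclei" and a: "j a \<noteq> top"
  obtains p where "meet_prime p" "a \<le> p" "j p = p"
proof -
  \<comment> \<open>The open nucleus of \<open>a\<close> sends \<open>a\<close> to
    \<open>top\<close> while \<open>j\<close> does not, so a prime nucleus \<open>k\<close> above
    \<open>j\<close> can be separated from it.\<close>
  have "frame_imp a a = top"
    by (simp add: top_unique[symmetric] le_frame_imp_iff)
  then have "\<not> frame_imp a \<le> j"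
    using a by (metis le_funD top_unique)
  then obtain k where k: "k \<in> nuclei" "j \<le> k" "\<not> frame_imp a \<le> k"
    and pr: "\<And>f g. f \<in> nuclei \<Longrightarrow> g \<in> nuclei \<Longrightarrow>
      (\<And>d. d \<in> nuclei \<Longrightarrow> d \<le> f \<Longrightarrow> d \<le> g \<Longrightarrow> d \<le> k) \<Longrightarrow> f \<le> k \<or> g \<le> k"
    using spatial_prime_separation[OF sp nuclei_frame_imp j] by metis
  define p where "p = k bot"
  have compl: "b \<le> p \<or> k b = top" for b
  proof -
    have "d \<le> k" if "d \<le> sup b" "d \<le> frame_imp b" for d
    proof (rule le_funI)
      fix x
      have "d x \<le> inf (sup b x) (frame_imp b x)"
        using that by (simp add: le_fun_def)
      also have "\<dots> = sup (inf b (frame_imp b x)) (inf x (frame_imp b x))"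
        by (rule inf_sup_distrib2)
      also have "\<dots> \<le> x"
        using inf_frame_imp_le by simp
      also have "x \<le> k x"
        by (rule nuclei_increasing[OF k(1)])
      finally show "d x \<le> k x" .
    qed
    then consider "sup b \<le> k" | "frame_imp b \<le> k"
      using pr[OF nuclei_sup nuclei_frame_imp] by blast
    then show ?thesis
    proof cases
      case 1
      then have "sup b bot \<le> k bot"
        by (rule le_funD)
      then show ?thesis
        by (simp add: p_def)
    next
      case 2
      then have "frame_imp b b \<le> k b"
        by (rule le_funD)
      moreover have "top \<le> frame_imp b b"
        by (simp add: le_frame_imp_iff)
      ultimately show ?thesis
        by (meson order_trans top_unique)
    qed
  qed
  have kp: "k p = p"
    unfolding p_def by (rule nuclei_idem[OF k(1)])
  \<comment> \<open>Every nucleus sending \<open>a\<close> to \<open>top\<close> lies above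
    \<open>frame_imp a\<close>, which \<open>k\<close> was chosen to avoid.\<close>
  have ka: "k a \<noteq> top"
  proof
    assume top: "k a = top"
    have "frame_imp a x \<le> k x" for x
    proof -
      have "frame_imp a x \<le> inf (k a) (k (frame_imp a x))"
        using nuclei_increasing[OF k(1)] by (simp add: top)
      also have "\<dots> \<le> k x"
        using nuclei_mono[OF k(1) inf_frame_imp_le] nuclei_inf[OF k(1)] by metis
      finally show ?thesis .
    qed
    then show False
      using k(3) by (simp add: le_fun_def)
  qed
  have ap: "a \<le> p"
    using compl ka by blast
  have p_top: "p \<noteq> top"
    using ka nuclei_mono[OF k(1) ap] kp ap by (metis nuclei_mono[OF k(1) bot_least] p_def top_unique)
  have "meet_prime p"
    unfolding meet_prime_def
  proof (intro conjI allI impI)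
    fix b c assume "inf b c \<le> p"
    then have "inf (k b) (k c) \<le> p"
      using nuclei_mono[OF k(1)] nuclei_inf[OF k(1)] kp by metis
    then show "b \<le> p \<or> c \<le> p"
      using compl[of b] compl[of c] p_top by (auto simp: top_unique)
  qed (rule p_top)
  moreover have "j p = p"
    using k(2) kp nuclei_increasing[OF j] by (metis le_funD order_antisym)
  ultimately show thesis
    using that ap by blast
qed


section \<open>Spatiality of the frame of nuclei\<close>

text \<open>The open sets are the sets \<open>h j\<close> of meet-primes moved by \<open>j\<close>.
  If \<open>h i \<subseteq> h j\<close>, every meet-prime fixed by \<open>j\<close> is fixed by
  \<open>i\<close>, so \<open>i x\<close> is below all fixed meet-primes of \<open>j\<close> above
  \<open>j x\<close>, and the assumption gives \<open>i x \<le> j x\<close>. Primeness turns meets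
  of nuclei into intersections.\<close>

lemma spatial_nuclei_if_fixed_meet_primes:
  assumes fixed: "\<And>(j :: 'a::frame \<Rightarrow> 'a) a b. j \<in> nuclei \<Longrightarrow> j a = a \<Longrightarrow>
    (\<And>p. meet_prime p \<Longrightarrow> j p = p \<Longrightarrow> a \<le> p \<Longrightarrow> b \<le> p) \<Longrightarrow> b \<le> a"
  shows "spatial (nuclei :: ('a \<Rightarrow> 'a) set)"
proof -
  define h where "h j = {p :: 'a. meet_prime p \<and> j p \<noteq> p}" for j
  define O' where "O' U \<longleftrightarrow> U \<in> h ` nuclei" for U
  have h_le: "h i \<subseteq> h j \<longleftrightarrow> i \<le> j" if ij: "i \<in> nuclei" "j \<in> nuclei" for i j
  proof
    assume sub: "h i \<subseteq> h j"
    show "i \<le> j"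
    proof (rule le_funI)
      fix x
      show "i x \<le> j x"
      proof (rule fixed[OF ij(2)])
        show "j (j x) = j x"
          by (rule nuclei_idem[OF ij(2)])
        fix p assume p: "meet_prime p" "j p = p" "j x \<le> p"
        then have "i p = p"
          using sub by (auto simp: h_def)
        moreover have "x \<le> p"
          using nuclei_increasing[OF ij(2)] p(3) order_trans by blast
        ultimately show "i x \<le> p"
          using nuclei_mono[OF ij(1)] by metis
      qed
    qed
  next
    assume "i \<le> j"
    then show "h i \<subseteq> h j"
      unfolding h_def using nuclei_increasing[OF ij(1)] by (auto simp: le_fun_def) (metis order_antisym)
  qed
  have "istopology O'"
    unfolding istopology_def
  proof (intro conjI allI impI)
    fix U V assume "O' U" "O' V"
    then obtain i j where ij: "i \<in> nuclei" "j \<in> nuclei" "U = h i" "V = h j"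
      by (auto simp: O'_def)
    have n: "inf i j \<in> nuclei"
      using nuclei_Inf[of "{i, j}"] ij by simp
    have "p \<in> h (inf i j) \<longleftrightarrow> p \<in> h i \<and> p \<in> h j" for p
    proof -
      have "inf (i p) (j p) = p \<longleftrightarrow> i p = p \<or> j p = p" if "meet_prime p"
      proof
        assume "inf (i p) (j p) = p"
        then have "i p \<le> p \<or> j p \<le> p"
          using that by (simp add: meet_prime_def)
        then show "i p = p \<or> j p = p"
          using nuclei_increasing ij order_antisym by blast
      next
        assume "i p = p \<or> j p = p"
        then show "inf (i p) (j p) = p"
          using nuclei_increasing[OF ij(1), of p] nuclei_increasing[OF ij(2), of p]
          by (auto simp: inf_absorb1 inf_absorb2)
      qed
      then show ?thesis
        by (auto simp: h_def)
    qed
    then show "O' (U \<inter> V)"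
      unfolding O'_def ij using n by blast
  next
    fix \<U> assume \<U>: "\<forall>U\<in>\<U>. O' U"
    \<comment> \<open>\<open>J\<close> is the join of \<open>K\<close> among nuclei, the least
      nucleus above \<open>K\<close>; a pointwise join need not be a nucleus.\<close>
    define K where "K = {j \<in> nuclei. h j \<in> \<U>}"
    define J where "J = Inf {i \<in> nuclei. \<forall>j\<in>K. j \<le> i}"
    have J: "J \<in> nuclei"
      unfolding J_def by (rule nuclei_Inf) blast
    have "j \<le> J" if "j \<in> K" for j
      unfolding J_def by (rule Inf_greatest) (use that in auto)
    then have "h j \<subseteq> h J" if "j \<in> K" for j
      using that h_le J by (simp add: K_def)
    moreover have "\<exists>j\<in>K. p \<in> h j" if "p \<in> h J" for p
    proof (rule ccontr)
      assume no: "\<not> (\<exists>j\<in>K. p \<in> h j)"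
      have p: "meet_prime p" "J p \<noteq> p"
        using that by (auto simp: h_def)
      \<comment> \<open>If every member of \<open>K\<close> fixes \<open>p\<close>, then
        \<open>prime_nucleus p\<close> is an upper bound of \<open>K\<close>, so \<open>J\<close>
        fixes \<open>p\<close> too.\<close>
      have "j \<le> prime_nucleus p" if "j \<in> K" for j
        by (rule nuclei_le_prime_nucleus) (use that no p in \<open>auto simp: K_def h_def\<close>)
      then have "J \<le> prime_nucleus p"
        unfolding J_def using nuclei_prime_nucleus[OF p(1)] by (intro Inf_lower) auto
      then have "J p \<le> p"
        by (auto simp: prime_nucleus_def dest!: le_funD[of _ _ p])
      then show False
        using p(2) nuclei_increasing[OF J] by (metis order_antisym)
    qed
    moreover have "\<Union>\<U> = \<Union>(h ` K)"
      using \<U> by (fastforce simp: K_def O'_def)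
    ultimately have "\<Union>\<U> = h J"
      by blast
    then show "O' (\<Union>\<U>)"
      using J by (simp add: O'_def)
  qed
  then have op: "openin (topology O') U \<longleftrightarrow> O' U" for U
    by (simp add: topology_inverse')
  have "inj_on h nuclei"
    using h_le by (intro inj_onI) (metis order_antisym order_refl)
  then have "order_iso h nuclei {U. openin (topology O') U}"
    unfolding order_iso_def bij_betw_def op O'_def using h_le by auto
  then show ?thesis
    by (rule spatial_if_order_iso)
qed

lemma spatial_nuclei_iff:
  "spatial (nuclei :: ('a::frame \<Rightarrow> 'a) set) \<longleftrightarrow>
    (\<forall>a::'a. a \<noteq> top \<longrightarrow> (\<exists>p u. meet_prime p \<and> a \<le> p \<and> \<not> u \<le> p \<and> inf u p \<le> a))"
proof (intro iffI allI impI)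
  fix a :: 'a assume sp: "spatial (nuclei :: ('a \<Rightarrow> 'a) set)" and a: "a \<noteq> top"
  let ?j = "\<lambda>x. frame_imp (frame_imp x a) a"
  have "frame_imp a a = top"
    by (simp add: top_unique[symmetric] le_frame_imp_iff)
  then have "?j a \<le> a"
    using inf_frame_imp_le[of top a] by simp
  then have "?j a \<noteq> top"
    using a by (auto simp: top_unique)
  then obtain p where p: "meet_prime p" "a \<le> p" "?j p = p"
    using fixed_meet_prime_above[OF sp nuclei_double_negation] by blast
  \<comment> \<open>The witness \<open>u\<close> is \<open>frame_imp p a\<close>. Were it below
    \<open>p\<close>, it would be below \<open>a\<close>, and the double negation of
    \<open>p\<close>, which is \<open>p\<close>, would be \<open>top\<close>.\<close>
  have "\<not> frame_imp p a \<le> p"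
  proof
    assume "frame_imp p a \<le> p"
    then have "frame_imp p a \<le> a"
      using inf_frame_imp_le[of p a] by (simp add: inf_absorb2)
    then have "top \<le> ?j p"
      by (simp add: le_frame_imp_iff)
    then show False
      using p by (simp add: meet_prime_def top_unique)
  qed
  moreover have "inf (frame_imp p a) p \<le> a"
    using inf_frame_imp_le[of p a] by (simp add: inf_commute)
  ultimately show "\<exists>p u. meet_prime p \<and> a \<le> p \<and> \<not> u \<le> p \<and> inf u p \<le> a"
    using p by blast
next
  assume ws: "\<forall>a::'a. a \<noteq> top \<longrightarrow> (\<exists>p u. meet_prime p \<and> a \<le> p \<and> \<not> u \<le> p \<and> inf u p \<le> a)"
  show "spatial (nuclei :: ('a \<Rightarrow> 'a) set)"
  proof (rule spatial_nuclei_if_fixed_meet_primes)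
    fix j :: "'a \<Rightarrow> 'a" and a b
    assume j: "j \<in> nuclei" and a: "j a = a"
      and b: "\<And>p. meet_prime p \<Longrightarrow> j p = p \<Longrightarrow> a \<le> p \<Longrightarrow> b \<le> p"
    let ?a = "frame_imp b a"
    show "b \<le> a"
    proof (rule ccontr)
      assume "\<not> b \<le> a"
      then have "?a \<noteq> top"
        using inf_frame_imp_le[of b a] by auto
      then obtain p u where p: "meet_prime p" "?a \<le> p" "\<not> u \<le> p" "inf u p \<le> ?a"
        using ws by blast
      \<comment> \<open>Primeness of \<open>p\<close> and \<open>\<not> u \<le> p\<close> give the
        nontrivial inequality. In this form \<open>p\<close> arises from the fixed element
        \<open>a\<close> by two implications, so \<open>j\<close> fixes it.\<close>
      have "p = frame_imp u ?a"
      proof (rule order_antisym)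
        show "p \<le> frame_imp u ?a"
          using p(4) by (simp only: le_frame_imp_iff)
        have "inf u (frame_imp u ?a) \<le> p"
          using inf_frame_imp_le p(2) order_trans by blast
        then show "frame_imp u ?a \<le> p"
          using p by (auto simp: meet_prime_def)
      qed
      then have "j p = p"
        using nuclei_frame_imp_fixed[OF j] a by metis
      moreover have "a \<le> p"
        using p(2) by (meson inf_le2 le_frame_imp_iff order_trans)
      ultimately have "b \<le> p"
        using b p(1) by blast
      \<comment> \<open>Because \<open>b \<le> p\<close>, the factor \<open>p\<close> can be
        inserted for free, and the factorisation pushes \<open>u\<close> below \<open>?a\<close>,
        hence below \<open>p\<close>.\<close>
      then have "inf b u \<le> inf b (inf u p)"
        by (simp add: inf.coboundedI1)
      also have "\<dots> \<le> a"
        using p(4) unfolding le_frame_imp_iff .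
      finally have "u \<le> ?a"
        by (simp add: le_frame_imp_iff)
      then show False
        using p(2,3) order_trans by blast
    qed
  qed
qed

theorem theorem7p3:
  assumes "spatial (UNIV :: 'a::frame set)"
  shows "spatial (nuclei :: ('a \<Rightarrow> 'a) set) \<longleftrightarrow>
         weakly_scattered (nuclear_topology :: 'a set topology)"
  using spatial_nuclei_iff weakly_scattered_iff[OF assms] by blast

end
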